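(* Let $L=\left\{z=x+yi : x,y\in\mathbb{R},\ x+\sqrt3\,y=1,\ -\frac12<x<\frac{1-\sqrt3}{1+\sqrt3}\right\}\subseteq\mathbb{C}$. Then no point of $L$ is an eigenvalue of any $4\times 4$ permutative doubly stochastic matrix.
   Context: A real matrix is doubly stochastic if its entries are nonnegative and every row and column sums to $1$. A matrix is permutative if every row is a permutation of its first row. A permutative doubly stochastic (PDS) matrix is one that is both. *)

theory Defs
  imports Complex_Main "HOL-Combinatorics.Permutations" "Jordan_Normal_Form.Char_Poly"
begin

definition doubly_stochastic :: "real mat \<Rightarrow> bool" where
  "doubly_stochastic A \<longleftrightarrow>
     square_mat A \<and>
     (\<forall>i<dim_row A. \<forall>j<dim_col A. 0 \<le> A $$ (i, j)) \<and>
     (\<forall>i<dim_row A. (\<Sum>j<dim_col A. A $$ (i, j)) = 1) \<and>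
     (\<forall>j<dim_col A. (\<Sum>i<dim_row A. A $$ (i, j)) = 1)"

(* Rows are indexed from 0, so the first row is row 0; the permutation of its entries
   may depend on the row i. *)
definition permutative :: "'a mat \<Rightarrow> bool" where
  "permutative A \<longleftrightarrow>
     (\<forall>i<dim_row A. \<exists>p. p permutes {..<dim_col A} \<and>
        (\<forall>j<dim_col A. A $$ (i, j) = A $$ (0, p j)))"

definition PDS :: "real mat \<Rightarrow> bool" where
  "PDS A \<longleftrightarrow> permutative A \<and> doubly_stochastic A"

definition L :: "complex set" where
  "L = {z. \<exists>x y :: real. z = Complex x y \<and> x + sqrt 3 * y = 1 \<and>
           - 1 / 2 < x \<and> x < (1 - sqrt 3) / (1 + sqrt 3)}"

end

theory Submission
  imports Defs
begin

text \<open>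
  Write \<open>\<omega>\<close> for the primitive cube root of unity in the upper half plane. The segment \<open>L\<close> is the part
  of the edge from \<open>\<omega>\<close> to \<open>1\<close> of the triangle of cube roots of unity that lies outside the square of
  fourth roots of unity. Suppose that \<open>lam \<in> L\<close> is an eigenvalue of the permutative doubly stochastic
  matrix \<open>a\<close>, with eigenvector \<open>z\<close>; then the entries of \<open>z\<close> sum to zero.

  Since \<open>(cmod lam)\<^sup>2 > 1 / 2\<close>, Schur's inequality
  (\<open>frobenius_ge_complex_eigenvalue\<close>) makes the sum of the squares of all entries larger than \<open>2\<close>.
  All rows have the same entries, so each row has squared norm above \<open>1 / 2\<close> and therefore a largest
  entry \<open>m > 1 / 2\<close>. By the column sums no column contains two such entries, so that they occupy the
  positions of a permutation \<open>\<pi>\<close>. If \<open>\<pi>\<close> is an involution, the matrix is so close to being symmetric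
  that \<open>Im lam \<le> 1 - m < 1 / 2\<close> (\<open>Im_eigenvalue_le_if_heavy_involution\<close>), which is false on \<open>L\<close>.
  So \<open>\<pi>\<close> is a three-cycle or a four-cycle.

  Permute the rows to bring the entries \<open>m\<close> to the diagonal. By \<open>latin_pattern_cases\<close>, the resulting
  matrix \<open>g\<close> is patterned after the table of quotients \<open>x\<inverse> y\<close> in the Klein four group or in a cyclic
  group of order four, and \<open>a\<close> is the product of the permutation matrix of \<open>\<pi>\<close> and \<open>g\<close>. Up to
  relabelling there are only five combinations of \<open>\<pi>\<close> and a pattern. On the three-dimensional space of vectors
  with sum zero each gives an explicit real cubic equation for \<open>lam\<close>. In the Klein cases \<open>lam\<close>,
  \<open>lam\<^sup>2\<close> or \<open>lam ^ 3\<close> is real; if \<open>a\<close> is a circulant, then \<open>lam\<close> is real or lies in the square. The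
  two remaining cubics are excluded by comparing real and imaginary parts, in \<open>three_cycle_cubic_not_on_L\<close> and
  \<open>four_cycle_cubic_not_on_L\<close>.
\<close>

section \<open>The segment\<close>

text \<open>
  The segment is parametrised by \<open>lam = e + (1 - e) * \<omega>\<close> with \<open>\<omega>\<close> the primitive cube root of unity in
  the upper half plane, so that the entire argument can be carried out with the real number \<open>e\<close>.
  The last bound places the point strictly outside the square with vertices \<open>\<plusminus>1, \<plusminus>\<i>\<close>; the bound
  \<open>e < 1 / 6\<close> is a rational relaxation of the same condition, the exact value being
  \<open>(2 * sqrt 3 - 3) / 3\<close>.
\<close>

lemma L_coordinates:
  assumes "lam \<in> L"
  obtains e where "Re lam = - 1 / 2 + 3 / 2 * e" "(Im lam)\<^sup>2 = 3 / 4 * (1 - e)\<^sup>2"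
    "0 < Im lam" "0 < e" "e < 1 / 6" "1 < Im lam - Re lam"
proof -
  obtain x y where xy: "lam = Complex x y" "x + sqrt 3 * y = 1" "- 1 / 2 < x"
      "x < (1 - sqrt 3) / (1 + sqrt 3)"
    using assms by (auto simp: L_def)
  define e where "e = (1 + 2 * x) / 3"
  have s3: "sqrt 3 * sqrt 3 = (3::real)" "sqrt 3 > (0::real)" by simp_all
  have "5 / 3 < sqrt (3::real)" by (rule real_less_rsqrt) (simp add: power2_eq_square)
  then have "(1 - sqrt 3) / (1 + sqrt 3) < (- 1 / 4 :: real)" by (simp add: field_simps)
  then have x4: "x < - 1 / 4" using xy(4) by simp
  have xs: "x * (1 + sqrt 3) < 1 - sqrt 3"
    using xy(4) s3 by (simp add: field_simps)
  have "(sqrt 3 * y)\<^sup>2 = (1 - x)\<^sup>2" using xy(2) by (metis add_diff_cancel_left')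
  then have y2: "y\<^sup>2 = 3 / 4 * (1 - e)\<^sup>2"
    by (simp add: e_def power2_eq_square field_simps)
  have "sqrt 3 * y > 0" using xy(2) x4 by simp
  then have y0: "y > 0" by (simp add: zero_less_mult_iff)
  have "sqrt 3 * (y - x) > sqrt 3 * 1" using xs xy(2) by (simp add: algebra_simps)
  then have "1 < y - x" using s3(2) mult_less_cancel_left_pos by blast
  then show ?thesis using xy(1,3) x4 y2 y0 by (intro that[of e]) (simp_all add: e_def field_simps)
qed

text \<open>
  The real part of the cubic equation, and its imaginary part divided by \<open>Im lam\<close>, involve only
  \<open>Re lam\<close> and \<open>(Im lam)\<^sup>2\<close>, both of which are polynomials in \<open>e\<close>.
\<close>

lemma L_root_of_cubic:
  fixes A B C :: real and lam :: complex
  assumes "lam \<in> L" and cubic: "lam ^ 3 + A * lam\<^sup>2 + B * lam + C = 0"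
  obtains e where "0 < e" "e < 1 / 6"
    "1 - 9 / 2 * e + 9 / 2 * e\<^sup>2 - A * (1 / 2 - 3 / 2 * e\<^sup>2) - B * (1 / 2 - 3 / 2 * e) + C = 0"
    "A * (1 - 3 * e) = B - 3 * e * (1 - 2 * e)"
proof -
  obtain e where e: "Re lam = - 1 / 2 + 3 / 2 * e" "(Im lam)\<^sup>2 = 3 / 4 * (1 - e)\<^sup>2"
    "0 < Im lam" "0 < e" "e < 1 / 6" using L_coordinates[OF assms(1)] by metis
  define x where "x = Re lam"
  define y where "y = Im lam"
  have lam: "lam = Complex x y" by (simp add: x_def y_def)
  have "Re (lam ^ 3 + A * lam\<^sup>2 + B * lam + C) = x ^ 3 - 3 * x * y\<^sup>2 + A * (x\<^sup>2 - y\<^sup>2) + B * x + C"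
    by (simp add: lam power2_eq_square power3_eq_cube algebra_simps)
  then have re: "x ^ 3 - 3 * x * y\<^sup>2 + A * (x\<^sup>2 - y\<^sup>2) + B * x + C = 0" by (simp add: cubic)
  have "Im (lam ^ 3 + A * lam\<^sup>2 + B * lam + C) = y * (3 * x\<^sup>2 - y\<^sup>2 + 2 * A * x + B)"
    by (simp add: lam power2_eq_square power3_eq_cube algebra_simps)
  then have im: "3 * x\<^sup>2 - y\<^sup>2 + 2 * A * x + B = 0" using cubic e(3) by (simp add: y_def)
  have xy: "x = - (1 / 2 - 3 / 2 * e)" "y\<^sup>2 = 3 / 4 * (1 - e)\<^sup>2"
    using e(1,2) by (simp_all add: x_def y_def)
  have x3: "x ^ 3 - 3 * x * y\<^sup>2 = 1 - 9 / 2 * e + 9 / 2 * e\<^sup>2"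
    unfolding xy by (simp add: power2_eq_square power3_eq_cube field_simps)
  have x2: "x\<^sup>2 - y\<^sup>2 = - (1 / 2 - 3 / 2 * e\<^sup>2)" "3 * x\<^sup>2 - y\<^sup>2 = - (3 * e * (1 - 2 * e))"
    unfolding xy by (simp_all add: power2_eq_square field_simps)
  show ?thesis
  proof (rule that[OF e(4,5)])
    show "1 - 9 / 2 * e + 9 / 2 * e\<^sup>2 - A * (1 / 2 - 3 / 2 * e\<^sup>2) - B * (1 / 2 - 3 / 2 * e) + C = 0"
      using re unfolding x3 x2 by (simp only: xy(1))
    show "A * (1 - 3 * e) = B - 3 * e * (1 - 2 * e)"
      using im unfolding x2 by (simp add: xy(1) algebra_simps)
  qed
qed

section \<open>Spectral bounds\<close>

text \<open>
  Bessel's inequality for the orthogonal vectors \<open>1\<close>, \<open>p\<close> and \<open>q\<close>.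
\<close>

lemma sum_squares_orthogonal_ge:
  fixes r p q :: "'a \<Rightarrow> real"
  assumes "finite I" "I \<noteq> {}"
    and "sum p I = 0" "sum q I = 0" "(\<Sum>j\<in>I. p j * q j) = 0"
    and "(\<Sum>j\<in>I. (p j)\<^sup>2) > 0" "(\<Sum>j\<in>I. (q j)\<^sup>2) > 0"
  shows "(sum r I)\<^sup>2 / real (card I) + (\<Sum>j\<in>I. r j * p j)\<^sup>2 / (\<Sum>j\<in>I. (p j)\<^sup>2)
           + (\<Sum>j\<in>I. r j * q j)\<^sup>2 / (\<Sum>j\<in>I. (q j)\<^sup>2) \<le> (\<Sum>j\<in>I. (r j)\<^sup>2)"
proof -
  define n where "n = real (card I)"
  define P where "P = (\<Sum>j\<in>I. (p j)\<^sup>2)"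
  define Q where "Q = (\<Sum>j\<in>I. (q j)\<^sup>2)"
  define \<alpha> where "\<alpha> = sum r I / n"
  define \<beta> where "\<beta> = (\<Sum>j\<in>I. r j * p j) / P"
  define \<gamma> where "\<gamma> = (\<Sum>j\<in>I. r j * q j) / Q"
  have pos: "n > 0" "P > 0" "Q > 0"
    using assms by (auto simp: n_def P_def Q_def card_gt_0_iff)
  have r: "sum r I = \<alpha> * n" "(\<Sum>j\<in>I. r j * p j) = \<beta> * P" "(\<Sum>j\<in>I. r j * q j) = \<gamma> * Q"
    using pos by (simp_all add: \<alpha>_def \<beta>_def \<gamma>_def)
  have "0 \<le> (\<Sum>j\<in>I. (r j - \<alpha> - \<beta> * p j - \<gamma> * q j)\<^sup>2)"
    by (simp add: sum_nonneg)
  also have "\<dots> = (\<Sum>j\<in>I. (r j)\<^sup>2 + \<alpha>\<^sup>2 + \<beta>\<^sup>2 * (p j)\<^sup>2 + \<gamma>\<^sup>2 * (q j)\<^sup>2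
      - 2 * \<alpha> * r j - 2 * \<beta> * (r j * p j) - 2 * \<gamma> * (r j * q j)
      + 2 * \<alpha> * \<beta> * p j + 2 * \<alpha> * \<gamma> * q j + 2 * \<beta> * \<gamma> * (p j * q j))"
    by (intro sum.cong refl) (simp add: power2_eq_square algebra_simps)
  also have "\<dots> = (\<Sum>j\<in>I. (r j)\<^sup>2) + n * \<alpha>\<^sup>2 + \<beta>\<^sup>2 * P + \<gamma>\<^sup>2 * Q
      - 2 * \<alpha> * (\<alpha> * n) - 2 * \<beta> * (\<beta> * P) - 2 * \<gamma> * (\<gamma> * Q)"
    unfolding sum.distrib sum_subtractf
    by (simp add: assms r P_def[symmetric] Q_def[symmetric] n_def[symmetric]
          flip: sum_distrib_left)
  finally have "\<alpha>\<^sup>2 * n + \<beta>\<^sup>2 * P + \<gamma>\<^sup>2 * Q \<le> (\<Sum>j\<in>I. (r j)\<^sup>2)"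
    by (simp add: power2_eq_square algebra_simps)
  moreover have "(\<alpha> * n)\<^sup>2 / n = \<alpha>\<^sup>2 * n" "(\<beta> * P)\<^sup>2 / P = \<beta>\<^sup>2 * P" "(\<gamma> * Q)\<^sup>2 / Q = \<gamma>\<^sup>2 * Q"
    using pos by (simp_all add: power2_eq_square)
  ultimately show ?thesis
    by (simp only: r P_def[symmetric] Q_def[symmetric] n_def[symmetric])
qed

text \<open>
  A special case of Schur's inequality between the eigenvalues and the Frobenius norm, for the
  eigenvalues \<open>1\<close>, \<open>lam\<close> and \<open>cnj lam\<close>. After multiplication of the eigenvector by a suitable
  scalar its real and imaginary parts are orthogonal, and Bessel's inequality applies to every row.
  Both conjugate eigenvalues must be counted: the weaker bound with a single \<open>(cmod lam)\<^sup>2\<close> would not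
  suffice to find an entry larger than \<open>1 / 2\<close>.
\<close>

lemma frobenius_ge_complex_eigenvalue:
  fixes a :: "'a \<Rightarrow> 'a \<Rightarrow> real" and z :: "'a \<Rightarrow> complex"
  assumes I: "finite I"
    and row: "\<And>i. i \<in> I \<Longrightarrow> (\<Sum>j\<in>I. a i j) = 1"
    and eig: "\<And>i. i \<in> I \<Longrightarrow> lam * z i = (\<Sum>j\<in>I. of_real (a i j) * z j)"
    and z0: "sum z I = 0" and nz: "\<exists>i\<in>I. z i \<noteq> 0" and im: "Im lam \<noteq> 0"
  shows "1 + 2 * (cmod lam)\<^sup>2 \<le> (\<Sum>i\<in>I. \<Sum>j\<in>I. (a i j)\<^sup>2)"
proof -
  \<comment> \<open>\<open>Re (c * z)\<close> and \<open>Im (c * z)\<close> are orthogonal exactly if \<open>c\<^sup>2 * T\<close> is real\<close>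
  define T where "T = (\<Sum>j\<in>I. (z j)\<^sup>2)"
  define c where "c = (if T = 0 then 1 else csqrt (cnj T))"
  have c: "c \<noteq> 0" "Im (c\<^sup>2 * T) = 0"
    by (simp_all add: c_def)
  define p where "p j = Re (c * z j)" for j
  define q where "q j = Im (c * z j)" for j
  define P where "P = (\<Sum>j\<in>I. (p j)\<^sup>2)"
  define Q where "Q = (\<Sum>j\<in>I. (q j)\<^sup>2)"
  define x where "x = Re lam"
  define y where "y = Im lam"
  have cz: "lam * (c * z i) = (\<Sum>j\<in>I. of_real (a i j) * (c * z j))" if "i \<in> I" for i
  proof -
    have "lam * (c * z i) = c * (lam * z i)" by (simp add: mult_ac)
    then show ?thesis by (simp add: eig[OF that] sum_distrib_left mult_ac)
  qed
  have Ap: "(\<Sum>j\<in>I. a i j * p j) = x * p i - y * q i" if "i \<in> I" for i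
    using arg_cong[OF cz[OF that], of Re] by (simp add: p_def q_def x_def y_def)
  have Aq: "(\<Sum>j\<in>I. a i j * q j) = y * p i + x * q i" if "i \<in> I" for i
    using arg_cong[OF cz[OF that], of Im] by (simp add: p_def q_def x_def y_def)
  have sumcz: "(\<Sum>j\<in>I. c * z j) = 0"
    using z0 by (simp flip: sum_distrib_left)
  have sp: "sum p I = 0" and sq: "sum q I = 0"
    using arg_cong[OF sumcz, of Re] arg_cong[OF sumcz, of Im] by (simp_all add: p_def q_def)
  have "c\<^sup>2 * T = (\<Sum>j\<in>I. (c * z j)\<^sup>2)"
    by (simp add: T_def sum_distrib_left power_mult_distrib)
  then have "Im (\<Sum>j\<in>I. (c * z j)\<^sup>2) = 0" using c by simp
  moreover have "Im ((c * z j)\<^sup>2) = 2 * (p j * q j)" for j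
    by (simp add: p_def q_def power2_eq_square)
  ultimately have spq: "(\<Sum>j\<in>I. p j * q j) = 0"
    by (simp flip: sum_distrib_left)
  have no_zero: "\<not> (\<forall>i\<in>I. p i = 0 \<and> q i = 0)"
  proof
    assume "\<forall>i\<in>I. p i = 0 \<and> q i = 0"
    then have "\<forall>i\<in>I. c * z i = 0" by (simp add: p_def q_def complex_eq_iff)
    then show False using nz c(1) by simp
  qed
  have "P \<noteq> 0"
  proof
    assume "P = 0"
    then have "\<forall>j\<in>I. p j = 0" using I by (simp add: P_def sum_nonneg_eq_0_iff)
    then show False using Ap im no_zero by (simp add: y_def)
  qed
  have "Q \<noteq> 0"
  proof
    assume "Q = 0"
    then have "\<forall>j\<in>I. q j = 0" using I by (simp add: Q_def sum_nonneg_eq_0_iff)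
    then show False using Aq im no_zero by (simp add: y_def)
  qed
  have pos: "P > 0" "Q > 0"
    using \<open>P \<noteq> 0\<close> \<open>Q \<noteq> 0\<close> by (simp_all add: P_def Q_def less_le sum_nonneg)
  have ne: "I \<noteq> {}" using nz by auto
  have n: "real (card I) > 0" using I ne by (simp add: card_gt_0_iff)
  have "1 + 2 * (x\<^sup>2 + y\<^sup>2) \<le> 1 + 2 * x\<^sup>2 + y\<^sup>2 * (Q / P + P / Q)"
  proof -
    have "2 \<le> Q / P + P / Q"
      using pos sum_squares_bound[of P Q] by (simp add: field_simps power2_eq_square)
    then have "y\<^sup>2 * 2 \<le> y\<^sup>2 * (Q / P + P / Q)" by (intro mult_left_mono) auto
    then show ?thesis by simp
  qed
  also have "\<dots> = 1 + (x\<^sup>2 * P + y\<^sup>2 * Q) / P + (y\<^sup>2 * P + x\<^sup>2 * Q) / Q"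
    using pos by (simp add: field_simps)
  also have "\<dots> = (\<Sum>i\<in>I. 1 / real (card I) + (x * p i - y * q i)\<^sup>2 / P + (y * p i + x * q i)\<^sup>2 / Q)"
  proof -
    have "(x * p i - y * q i)\<^sup>2 = x\<^sup>2 * (p i)\<^sup>2 + y\<^sup>2 * (q i)\<^sup>2 - 2 * x * y * (p i * q i)"
      "(y * p i + x * q i)\<^sup>2 = y\<^sup>2 * (p i)\<^sup>2 + x\<^sup>2 * (q i)\<^sup>2 + 2 * x * y * (p i * q i)" for i
      by (simp_all add: power2_eq_square algebra_simps)
    then have "(\<Sum>i\<in>I. (x * p i - y * q i)\<^sup>2) = x\<^sup>2 * P + y\<^sup>2 * Q"
      "(\<Sum>i\<in>I. (y * p i + x * q i)\<^sup>2) = y\<^sup>2 * P + x\<^sup>2 * Q"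
      by (simp_all add: sum.distrib sum_subtractf spq P_def Q_def flip: sum_distrib_left)
    then show ?thesis using n
      by (simp add: sum.distrib flip: sum_divide_distrib)
  qed
  also have "\<dots> \<le> (\<Sum>i\<in>I. \<Sum>j\<in>I. (a i j)\<^sup>2)"
  proof (rule sum_mono)
    fix i assume i: "i \<in> I"
    show "1 / real (card I) + (x * p i - y * q i)\<^sup>2 / P + (y * p i + x * q i)\<^sup>2 / Q
        \<le> (\<Sum>j\<in>I. (a i j)\<^sup>2)"
      using sum_squares_orthogonal_ge[OF I ne sp sq spq, of "a i"] pos
      by (simp add: row[OF i] Ap[OF i] Aq[OF i] flip: P_def Q_def)
  qed
  finally show ?thesis by (simp add: cmod_power2 x_def y_def)
qed

text \<open>
  The unit column sums make the all-ones vector a left eigenvector for the eigenvalue \<open>1\<close>.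
\<close>

lemma doubly_stochastic_eigenvector_sum_0:
  fixes a :: "'a \<Rightarrow> 'a \<Rightarrow> real" and z :: "'a \<Rightarrow> complex"
  assumes col: "\<And>j. j \<in> I \<Longrightarrow> (\<Sum>i\<in>I. a i j) = 1"
    and eig: "\<And>i. i \<in> I \<Longrightarrow> lam * z i = (\<Sum>j\<in>I. of_real (a i j) * z j)"
    and "lam \<noteq> 1"
  shows "sum z I = 0"
proof -
  have "lam * sum z I = (\<Sum>i\<in>I. \<Sum>j\<in>I. of_real (a i j) * z j)"
    by (simp add: sum_distrib_left eig)
  also have "\<dots> = (\<Sum>j\<in>I. of_real (\<Sum>i\<in>I. a i j) * z j)"
    by (subst sum.swap) (simp add: sum_distrib_right)
  also have "\<dots> = sum z I" by (simp add: col)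
  finally show ?thesis using \<open>lam \<noteq> 1\<close> by simp
qed

text \<open>
  The matrix is \<open>m\<close> times a symmetric permutation matrix, whose quadratic form \<open>T\<close> is real, plus a
  remainder with all row and column sums \<open>1 - m\<close>, whose quadratic form \<open>R\<close> is at most \<open>1 - m\<close>
  times the squared norm by the arithmetic-geometric mean inequality.
\<close>

lemma Im_eigenvalue_le_if_heavy_involution:
  fixes a :: "'a \<Rightarrow> 'a \<Rightarrow> real" and z :: "'a \<Rightarrow> complex"
  assumes I: "finite I" and nonneg: "\<And>i j. i \<in> I \<Longrightarrow> j \<in> I \<Longrightarrow> 0 \<le> a i j"
    and row: "\<And>i. i \<in> I \<Longrightarrow> (\<Sum>j\<in>I. a i j) = 1"
    and col: "\<And>j. j \<in> I \<Longrightarrow> (\<Sum>i\<in>I. a i j) = 1"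
    and \<pi>: "\<And>i. i \<in> I \<Longrightarrow> \<pi> i \<in> I" "\<And>i. i \<in> I \<Longrightarrow> \<pi> (\<pi> i) = i"
    and m: "\<And>i. i \<in> I \<Longrightarrow> a i (\<pi> i) = m"
    and eig: "\<And>i. i \<in> I \<Longrightarrow> lam * z i = (\<Sum>j\<in>I. of_real (a i j) * z j)"
    and nz: "\<exists>i\<in>I. z i \<noteq> 0"
  shows "\<bar>Im lam\<bar> \<le> 1 - m"
proof -
  define S where "S = (\<Sum>i\<in>I. (cmod (z i))\<^sup>2)"
  define b where "b i j = a i j - (if j = \<pi> i then m else 0)" for i j
  have S: "S > 0"
    using nz I by (auto simp: S_def intro!: sum_pos2)
  have b0: "b i j \<ge> 0" if "i \<in> I" "j \<in> I" for i j
    using nonneg[OF that] m[OF that(1)] by (simp add: b_def)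
  have brow: "(\<Sum>j\<in>I. b i j) = 1 - m" if "i \<in> I" for i
    using row[OF that] \<pi>(1)[OF that] I by (simp add: b_def sum_subtractf)
  have bcol: "(\<Sum>i\<in>I. b i j) = 1 - m" if "j \<in> I" for j
  proof -
    have "(\<Sum>i\<in>I. if j = \<pi> i then m else 0) = (\<Sum>i\<in>I. if i = \<pi> j then m else 0)"
      using \<pi> that by (intro sum.cong) auto
    then show ?thesis using col[OF that] \<pi>(1)[OF that] I by (simp add: b_def sum_subtractf)
  qed
  define T where "T = (\<Sum>i\<in>I. cnj (z i) * z (\<pi> i))"
  define R where "R = (\<Sum>i\<in>I. \<Sum>j\<in>I. of_real (b i j) * (cnj (z i) * z j))"
  have "lam * of_real S = (\<Sum>i\<in>I. cnj (z i) * (lam * z i))"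
    by (simp add: S_def sum_distrib_left mult_ac flip: complex_norm_square of_real_power)
  also have "\<dots> = (\<Sum>i\<in>I. of_real m * (cnj (z i) * z (\<pi> i)) + (\<Sum>j\<in>I. of_real (b i j) * (cnj (z i) * z j)))"
  proof (intro sum.cong refl)
    fix i assume i: "i \<in> I"
    have "(\<Sum>j\<in>I. of_real (a i j) * z j)
        = (\<Sum>j\<in>I. (if j = \<pi> i then of_real m * z j else 0) + of_real (b i j) * z j)"
      by (intro sum.cong refl) (simp add: b_def algebra_simps)
    also have "\<dots> = of_real m * z (\<pi> i) + (\<Sum>j\<in>I. of_real (b i j) * z j)"
      using I \<pi>(1)[OF i] by (simp add: sum.distrib)
    finally show "cnj (z i) * (lam * z i)
        = of_real m * (cnj (z i) * z (\<pi> i)) + (\<Sum>j\<in>I. of_real (b i j) * (cnj (z i) * z j))"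
      by (simp add: eig[OF i] distrib_left sum_distrib_left mult_ac)
  qed
  also have "\<dots> = of_real m * T + R"
    by (simp add: sum.distrib T_def R_def sum_distrib_left)
  finally have split: "lam * of_real S = of_real m * T + R" .
  have "cnj T = (\<Sum>i\<in>I. z i * cnj (z (\<pi> i)))" by (simp add: T_def)
  also have "\<dots> = (\<Sum>i\<in>I. z (\<pi> i) * cnj (z (\<pi> (\<pi> i))))"
    by (rule sum.reindex_bij_witness[of _ \<pi> \<pi>]) (simp_all add: \<pi>)
  also have "\<dots> = T" by (simp add: T_def \<pi> mult.commute)
  finally have "Im T = 0" by (metis complex_cnj_cancel_iff complex_is_Real_iff Reals_cnj_iff)
  have half: "(\<Sum>i\<in>I. (1 - m) * ((cmod (z i))\<^sup>2 / 2)) = (1 - m) * S / 2"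
    by (simp add: S_def sum_distrib_left sum_divide_distrib)
  from \<open>Im T = 0\<close> have "Im lam * S = Im R" using arg_cong[OF split, of Im] by simp
  then have "\<bar>Im lam\<bar> * S \<le> cmod R"
    using abs_Im_le_cmod[of R] S by (metis abs_mult abs_of_pos)
  also have "\<dots> \<le> (\<Sum>i\<in>I. \<Sum>j\<in>I. b i j * (((cmod (z i))\<^sup>2 + (cmod (z j))\<^sup>2) / 2))"
    unfolding R_def
  proof (intro sum_norm_le)
    fix i j assume ij: "i \<in> I" "j \<in> I"
    have "cmod (z i) * cmod (z j) \<le> ((cmod (z i))\<^sup>2 + (cmod (z j))\<^sup>2) / 2"
      using sum_squares_bound[of "cmod (z i)" "cmod (z j)"] by simp
    from mult_left_mono[OF this b0[OF ij]]
    show "cmod (of_real (b i j) * (cnj (z i) * z j))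
        \<le> b i j * (((cmod (z i))\<^sup>2 + (cmod (z j))\<^sup>2) / 2)"
      using b0[OF ij] by (simp add: norm_mult)
  qed
  also have "\<dots> = (\<Sum>i\<in>I. \<Sum>j\<in>I. b i j * ((cmod (z i))\<^sup>2 / 2)) + (\<Sum>i\<in>I. \<Sum>j\<in>I. b i j * ((cmod (z j))\<^sup>2 / 2))"
    by (simp add: sum.distrib add_divide_distrib distrib_left)
  also have "(\<Sum>i\<in>I. \<Sum>j\<in>I. b i j * ((cmod (z i))\<^sup>2 / 2)) = (1 - m) * S / 2"
    by (simp only: brow half flip: sum_distrib_right cong: sum.cong)
  also have "(\<Sum>i\<in>I. \<Sum>j\<in>I. b i j * ((cmod (z j))\<^sup>2 / 2)) = (1 - m) * S / 2"
    by (subst sum.swap) (simp only: bcol half flip: sum_distrib_right cong: sum.cong)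
  finally show ?thesis using S by simp
qed

section \<open>Latin patterns of order four\<close>

lemma mset3_cases:
  "{#x, y, w#} = {#b, c, d#} \<longleftrightarrow>
     x = b \<and> y = c \<and> w = d \<or> x = b \<and> y = d \<and> w = c \<or> x = c \<and> y = b \<and> w = d \<or>
     x = c \<and> y = d \<and> w = b \<or> x = d \<and> y = b \<and> w = c \<or> x = d \<and> y = c \<and> w = b"
  by (auto simp: add_eq_conv_diff add_mset_eq_single)

definition klein_pattern :: "('a \<Rightarrow> 'a \<Rightarrow> real) \<Rightarrow> 'a \<Rightarrow> 'a \<Rightarrow> 'a \<Rightarrow> 'a \<Rightarrow> bool" where
  "klein_pattern g p q r s \<longleftrightarrow>
     g q p = g p q \<and> g r s = g p q \<and> g s r = g p q \<and>
     g r p = g p r \<and> g q s = g p r \<and> g s q = g p r \<and>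
     g s p = g p s \<and> g q r = g p s \<and> g r q = g p s"

definition cyclic_pattern :: "('a \<Rightarrow> 'a \<Rightarrow> real) \<Rightarrow> 'a \<Rightarrow> 'a \<Rightarrow> 'a \<Rightarrow> 'a \<Rightarrow> bool" where
  "cyclic_pattern g p q r s \<longleftrightarrow>
     g q r = g p q \<and> g r s = g p q \<and> g s p = g p q \<and>
     g q s = g p r \<and> g r p = g p r \<and> g s q = g p r \<and>
     g q p = g p s \<and> g r q = g p s \<and> g s r = g p s"

text \<open>
  Deleting the constant diagonal of \<open>g\<close> leaves three numbers that occur in every row. If these are
  distinct, the column sums force a Latin square, and a Latin square of order four with constant
  diagonal is a table of quotients \<open>x\<inverse> y\<close> in the Klein four group or in a cyclic group. In a cyclic
  pattern the unordered pair of opposite points \<open>{p, r}, {q, s}\<close> determines the cycle up to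
  reversal, which gives three of them. With repeated values the patterns overlap, but one of them still holds. All
  of this is linear arithmetic over the finitely many arrangements of the rows.
\<close>

lemma latin_pattern_cases:
  fixes g :: "'a \<Rightarrow> 'a \<Rightarrow> real"
  assumes "{#g q p, g q r, g q s#} = {#g p q, g p r, g p s#}"
    and "{#g r p, g r q, g r s#} = {#g p q, g p r, g p s#}"
    and "{#g s p, g s q, g s r#} = {#g p q, g p r, g p s#}"
    and "g q p + g r p + g s p = g p q + g p r + g p s"
    and "g p q + g r q + g s q = g p q + g p r + g p s"
    and "g p r + g q r + g s r = g p q + g p r + g p s"
    and "g p s + g q s + g r s = g p q + g p r + g p s"
  shows "klein_pattern g p q r s \<or> cyclic_pattern g p q r s \<or>
         cyclic_pattern g p q s r \<or> cyclic_pattern g p r q s"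
  using assms unfolding mset3_cases klein_pattern_def cyclic_pattern_def
  by (smt (z3))

section \<open>Two cubics without roots on the segment\<close>

text \<open>
  For row sums \<open>1\<close>, diagonal entries \<open>m\<close> and a cyclic pattern \<open>b, c, d\<close> off the diagonal, the
  parameters are \<open>u = m - c\<close>, \<open>v = b - d\<close>, \<open>w = m + c - b - d\<close> and \<open>\<beta> = b + d\<close>.
  The imaginary part of the cubic forces \<open>\<beta> \<ge> 3 / 2 * e\<close>, and the real part forces
  \<open>1 - 9 / 2 * e + 9 / 2 * e\<^sup>2 \<le> (1 - 2 * \<beta>) * ((1 - \<beta>)\<^sup>2 + \<beta>\<^sup>2)\<close>. The right-hand side decreases
  in \<open>\<beta>\<close>, and already at \<open>\<beta> = 3 / 2 * e\<close> it is smaller than the left-hand side, by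
  \<open>3 / 2 * e * (1 - 3 * e)\<^sup>2\<close>.
\<close>

lemma three_cycle_cubic_not_on_L:
  fixes u v w \<beta> :: real and lam :: complex
  assumes "lam \<in> L" and w: "w = 1 - 2 * \<beta>" and "\<beta> < 1 / 2" "\<bar>v\<bar> \<le> \<beta>" "\<bar>u\<bar> \<le> 1 - \<beta>"
    and cubic: "lam ^ 3 + v * lam\<^sup>2 - w * v * lam - w * (u\<^sup>2 + v\<^sup>2) = 0"
  shows False
proof -
  have "lam ^ 3 + complex_of_real v * lam\<^sup>2 + complex_of_real (- (w * v)) * lam
          + complex_of_real (- (w * (u\<^sup>2 + v\<^sup>2))) = 0"
    using cubic by simp
  then obtain e where e: "0 < e" "e < 1 / 6" and
    re: "1 - 9 / 2 * e + 9 / 2 * e\<^sup>2 - v * (1 / 2 - 3 / 2 * e\<^sup>2) - - (w * v) * (1 / 2 - 3 / 2 * e)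
           + - (w * (u\<^sup>2 + v\<^sup>2)) = 0" and
    im: "v * (1 - 3 * e) = - (w * v) - 3 * e * (1 - 2 * e)"
    using L_root_of_cubic[OF assms(1)] by metis
  define v' where "v' = - v"
  define t where "t = 3 / 2 * e"
  have im': "v' * (2 - 2 * \<beta> - 3 * e) = 3 * e - 6 * e\<^sup>2"
    using im by (simp add: v'_def w power2_eq_square algebra_simps)
  have pos: "2 - 2 * \<beta> - 3 * e > 0" using assms(3) e by simp
  have "3 * e - 6 * e\<^sup>2 > 0" using e by (simp add: power2_eq_square)
  then have v0: "v' \<ge> 0" using im' pos by (metis less_le_not_le mult_neg_pos not_le_imp_less order.strict_trans)
  have le: "3 * e - 6 * e\<^sup>2 \<le> \<beta> * (2 - 2 * \<beta> - 3 * e)"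
    using im' pos assms(4) by (metis v'_def abs_le_D2 less_imp_le mult_right_mono)
  have tb: "t \<le> \<beta>"
  proof (rule ccontr)
    assume "\<not> t \<le> \<beta>"
    define \<delta> where "\<delta> = t - \<beta>"
    have "\<beta> * (2 - 2 * \<beta> - 3 * e) = 3 * e - 6 * e\<^sup>2 - 3 * e\<^sup>2 - \<delta> * (2 - 9 * e) - 2 * \<delta>\<^sup>2"
      by (simp add: \<delta>_def t_def power2_eq_square algebra_simps)
    moreover have "\<delta> * (2 - 9 * e) > 0" using \<open>\<not> t \<le> \<beta>\<close> e by (simp add: \<delta>_def)
    moreover have "3 * e\<^sup>2 \<ge> 0" "2 * \<delta>\<^sup>2 \<ge> 0" by simp_all
    ultimately show False using le by linarith
  qed
  have w0: "w > 0" "w \<le> 1 - 3 * e" using assms(3) tb by (simp_all add: w t_def)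
  have "w * (1 / 2 - 3 / 2 * e) \<le> (1 - 3 * e) * (1 / 2 - 3 / 2 * e)"
    using w0 e by (intro mult_right_mono) auto
  also have "\<dots> = (1 / 2 - 3 / 2 * e\<^sup>2) - 3 * e * (1 - 2 * e)"
    by (simp add: power2_eq_square algebra_simps) (simp add: field_simps)
  also have "\<dots> \<le> 1 / 2 - 3 / 2 * e\<^sup>2" using e by simp
  finally have "v' * (w * (1 / 2 - 3 / 2 * e)) \<le> v' * (1 / 2 - 3 / 2 * e\<^sup>2)"
    using v0 mult_left_mono by blast
  then have "1 - 9 / 2 * e + 9 / 2 * e\<^sup>2 \<le> w * (u\<^sup>2 + v\<^sup>2)"
    using re by (simp add: v'_def algebra_simps)
  also have "\<dots> \<le> w * ((1 - \<beta>)\<^sup>2 + \<beta>\<^sup>2)"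
    using w0 assms(4,5) by (intro mult_left_mono add_mono) (auto simp: abs_le_square_iff[symmetric])
  also have "\<dots> = 1 - 4 * \<beta> + 6 * \<beta>\<^sup>2 - 4 * \<beta> ^ 3"
    by (simp add: w power2_eq_square power3_eq_cube algebra_simps)
  also have "\<dots> \<le> 1 - 4 * t + 6 * t\<^sup>2 - 4 * t ^ 3"
  proof -
    \<comment> \<open>the second factor is the difference quotient of the cubic, completed to a sum of squares\<close>
    have "0 \<le> (\<beta> - t) * (3 * (\<beta> + t - 1)\<^sup>2 + 1 + (\<beta> - t)\<^sup>2)"
      using tb by (intro mult_nonneg_nonneg) auto
    then show ?thesis by (simp add: power2_eq_square power3_eq_cube algebra_simps)
  qed
  also have "\<dots> = 1 - 9 / 2 * e + 9 / 2 * e\<^sup>2 - 3 / 2 * e * (1 - 3 * e)\<^sup>2"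
    by (simp add: t_def power2_eq_square power3_eq_cube field_simps)
  also have "\<dots> < 1 - 9 / 2 * e + 9 / 2 * e\<^sup>2"
    using e by simp
  finally show False by simp
qed

text \<open>
  The imaginary part of the cubic gives \<open>w > 1 - 3 * e\<close>. The real part says that a quadratic
  polynomial in \<open>u\<close> with leading coefficient \<open>w\<close> equals \<open>- w * v\<^sup>2 \<le> 0\<close>, but for such \<open>w\<close> its
  discriminant is negative.
\<close>

lemma four_cycle_cubic_not_on_L:
  fixes u v w :: real and lam :: complex
  assumes "lam \<in> L" and "u > 0" and "w \<le> 1"
    and cubic: "lam ^ 3 + u * lam\<^sup>2 + w * u * lam + w * (u\<^sup>2 + v\<^sup>2) = 0"
  shows False
proof -
  have "lam ^ 3 + complex_of_real u * lam\<^sup>2 + complex_of_real (w * u) * lam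
          + complex_of_real (w * (u\<^sup>2 + v\<^sup>2)) = 0"
    using cubic by simp
  then obtain e where e: "0 < e" "e < 1 / 6" and
    re: "1 - 9 / 2 * e + 9 / 2 * e\<^sup>2 - u * (1 / 2 - 3 / 2 * e\<^sup>2) - w * u * (1 / 2 - 3 / 2 * e)
           + w * (u\<^sup>2 + v\<^sup>2) = 0" and
    im: "u * (1 - 3 * e) = w * u - 3 * e * (1 - 2 * e)"
    using L_root_of_cubic[OF assms(1)] by metis
  define k where "k = 1 - 3 * e"
  define g where "g = w * k"
  define B where "B = 1 / 2 - 3 / 2 * e\<^sup>2 + g / 2"
  have k: "1 / 2 < k" "k < 1" using e by (simp_all add: k_def)
  have "u * (w - k) = 3 * e * (1 - 2 * e)" using im by (simp add: k_def algebra_simps)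
  also have "\<dots> > 0" using e by simp
  finally have wk: "k < w" using assms(2) by (simp add: zero_less_mult_iff)
  have g: "g \<le> k" "1 / 4 \<le> g"
  proof -
    show "g \<le> k" using assms(3) k by (simp add: g_def mult_left_le_one_le)
    have "1 / 2 * (1 / 2) \<le> w * k" using wk k by (intro mult_mono) auto
    then show "1 / 4 \<le> g" by (simp add: g_def)
  qed
  have "e\<^sup>2 \<le> 1" using e by (simp add: power2_eq_square mult_le_one)
  have B: "0 \<le> B" "B \<le> (1 + g) / 2"
    using g \<open>e\<^sup>2 \<le> 1\<close> e mult_strict_mono[of e "1/6" e "1/6"] by (simp_all add: B_def power2_eq_square)
  have "B\<^sup>2 \<le> ((1 + g) / 2)\<^sup>2" using B by (intro power_mono) auto
  also have "\<dots> = (1 + g) * (1 + g) / 4" by (simp add: power2_eq_square)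
  also have "\<dots> < (1 + g) * (2 * g)"
  proof -
    have "(1 + g) * (1 + g) < (1 + g) * (8 * g)" using g by (intro mult_strict_left_mono) auto
    then show ?thesis by simp
  qed
  also have "\<dots> \<le> (1 + k) * (2 * g)" using g by (intro mult_right_mono) auto
  also have "\<dots> = 4 * w * (1 - 9 / 2 * e + 9 / 2 * e\<^sup>2)"
    by (simp add: g_def k_def power2_eq_square algebra_simps)
  finally have disc: "B\<^sup>2 < 4 * w * (1 - 9 / 2 * e + 9 / 2 * e\<^sup>2)" .
  have "1 - 9 / 2 * e + 9 / 2 * e\<^sup>2 - B * u + w * u\<^sup>2 = - (w * v\<^sup>2)"
    using re by (simp add: B_def g_def k_def field_simps)
  also have "\<dots> \<le> 0" using wk k by simp
  finally have "4 * w * (1 - 9 / 2 * e + 9 / 2 * e\<^sup>2 - B * u + w * u\<^sup>2) \<le> 0"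
    using wk k by (simp add: mult_le_0_iff)
  moreover have "4 * w * (1 - 9 / 2 * e + 9 / 2 * e\<^sup>2 - B * u + w * u\<^sup>2)
      = (2 * w * u - B)\<^sup>2 + (4 * w * (1 - 9 / 2 * e + 9 / 2 * e\<^sup>2) - B\<^sup>2)"
    by (simp add: power2_eq_square algebra_simps)
  ultimately show False using disc by (smt (verit) zero_le_power2)
qed

section \<open>Eigenvectors with sum zero\<close>

text \<open>
  Cramer's rule; the coefficients in the three identities are the entries of the adjugate matrix.
\<close>

lemma det3_eq_0_if_kernel:
  fixes a b c d e f g h i x y z :: "'a :: idom"
  assumes E1: "a * x + b * y + c * z = 0" and E2: "d * x + e * y + f * z = 0"
    and E3: "g * x + h * y + i * z = 0" and nz: "\<not> (x = 0 \<and> y = 0 \<and> z = 0)"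
  shows "a * (e * i - f * h) - b * (d * i - f * g) + c * (d * h - e * g) = 0" (is "?D = 0")
proof -
  have "?D * x = (e * i - f * h) * (a * x + b * y + c * z) - (b * i - c * h) * (d * x + e * y + f * z)
      + (b * f - c * e) * (g * x + h * y + i * z)"
    "?D * y = (f * g - d * i) * (a * x + b * y + c * z) + (a * i - c * g) * (d * x + e * y + f * z)
      - (a * f - c * d) * (g * x + h * y + i * z)"
    "?D * z = (d * h - e * g) * (a * x + b * y + c * z) - (a * h - b * g) * (d * x + e * y + f * z)
      + (a * e - b * d) * (g * x + h * y + i * z)"
    by (simp_all add: algebra_simps)
  then have "?D * x = 0" "?D * y = 0" "?D * z = 0" unfolding E1 E2 E3 by simp_all
  then show ?thesis using nz mult_eq_0_iff by blast
qed

text \<open>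
  The matrix under study has the entry \<open>m\<close> at all positions \<open>(i, \<pi> i)\<close>. Here \<open>g\<close> is that matrix with
  its rows rearranged so that these entries come to lie on the diagonal; this makes the pattern
  lemma applicable to \<open>g\<close>, while \<open>\<pi>\<close> only appears in the eigenvalue equation.
\<close>

locale permuted_eigenvector =
  fixes I :: "'a set" and g :: "'a \<Rightarrow> 'a \<Rightarrow> real" and \<pi> :: "'a \<Rightarrow> 'a"
    and m :: real and z :: "'a \<Rightarrow> complex" and lam :: complex
  assumes nonneg: "\<And>i j. i \<in> I \<Longrightarrow> j \<in> I \<Longrightarrow> 0 \<le> g i j"
    and row: "\<And>i. i \<in> I \<Longrightarrow> (\<Sum>j\<in>I. g i j) = 1"
    and col: "\<And>j. j \<in> I \<Longrightarrow> (\<Sum>i\<in>I. g i j) = 1"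
    and permutative: "\<And>i j. i \<in> I \<Longrightarrow> j \<in> I \<Longrightarrow> image_mset (g i) (mset_set I) = image_mset (g j) (mset_set I)"
    and diag: "\<And>i. i \<in> I \<Longrightarrow> g i i = m"
    and m: "1 / 2 < m"
    and eig: "\<And>i. i \<in> I \<Longrightarrow> lam * z i = (\<Sum>j\<in>I. of_real (g (\<pi> i) j) * z j)"
    and sum0: "sum z I = 0"
    and nz: "\<exists>i\<in>I. z i \<noteq> 0"
    and L: "lam \<in> L"
begin

definition Gz :: "'a \<Rightarrow> complex" where
  "Gz i = (\<Sum>j\<in>I. of_real (g i j) * z j)"

text \<open>
  For four points, the sums \<open>z p + z q\<close>, \<open>z p + z r\<close>, \<open>z p + z s\<close> are coordinates on the space of
  vectors with sum zero. Up to a factor they are the values of \<open>z\<close> under the nontrivial characters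
  of the Klein four group acting on \<open>{p, q, r, s}\<close>. Every permutation of the four points permutes
  them up to sign, and \<open>g\<close> acts on them by a diagonal matrix in the Klein case and by a rotation
  with dilation in a plane plus a scalar on the remaining axis in the cyclic case.
\<close>

context
  fixes p q r s :: 'a
  assumes I: "I = {p, q, r, s}" and dist: "distinct [p, q, r, s]"
begin

lemma sum4: "sum f I = f p + f q + f r + f s" for f :: "'a \<Rightarrow> 'b::comm_monoid_add"
  using dist by (simp add: I add.assoc)

lemma z_s: "z s = - z p - z q - z r"
proof -
  have "z p + z q + z r + z s = 0" using sum0 sum4[of z] by simp
  then have "z s = - (z p + z q + z r)" by (metis add.commute eq_neg_iff_add_eq_0)
  then show ?thesis by simp
qed

lemma coordinates_nonzero: "\<not> (z p + z q = 0 \<and> z p + z r = 0 \<and> z p + z s = 0)"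
proof
  assume *: "z p + z q = 0 \<and> z p + z r = 0 \<and> z p + z s = 0"
  have "2 * z p = (z p + z q) + (z p + z r) + (z p + z s) - (z p + z q + z r + z s)"
    by (simp add: algebra_simps)
  also have "\<dots> = 0" using * sum0 sum4[of z] by simp
  finally show False using * nz by (auto simp: I)
qed

lemma parameters:
  "0 \<le> g p q" "0 \<le> g p r" "0 \<le> g p s" "m + g p q + g p r + g p s = 1"
  using nonneg[of p] row[of p] diag[of p] unfolding sum4 by (simp_all add: I)

lemma eig4: "lam * z p = Gz (\<pi> p)" "lam * z q = Gz (\<pi> q)" "lam * z r = Gz (\<pi> r)" "lam * z s = Gz (\<pi> s)"
  using eig[of p] eig[of q] eig[of r] eig[of s] unfolding Gz_def by (simp_all add: I)

lemma klein_coordinates: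
  assumes "klein_pattern g p q r s"
  shows "Gz p + Gz q = (m + g p q - g p r - g p s) * (z p + z q)"
    "Gz p + Gz r = (m + g p r - g p q - g p s) * (z p + z r)"
    "Gz p + Gz s = (m + g p s - g p q - g p r) * (z p + z s)"
    "Gz q + Gz r = - (Gz p + Gz s)"
    "Gz q + Gz s = - (Gz p + Gz r)"
  using assms diag[of p] diag[of q] diag[of r] diag[of s] unfolding Gz_def sum4
  by (simp_all add: klein_pattern_def I z_s algebra_simps)

lemma cyclic_coordinates:
  assumes "cyclic_pattern g p q r s"
  shows "Gz p + Gz q = (m - g p r) * (z p + z q) - (g p q - g p s) * (z p + z s)"
    "Gz p + Gz r = (m + g p r - g p q - g p s) * (z p + z r)"
    "Gz p + Gz s = (m - g p r) * (z p + z s) + (g p q - g p s) * (z p + z q)"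
    "Gz q + Gz r = - (Gz p + Gz s)"
    "Gz q + Gz s = - (Gz p + Gz r)"
  using assms diag[of p] diag[of q] diag[of r] diag[of s] unfolding Gz_def sum4
  by (simp_all add: cyclic_pattern_def I z_s algebra_simps)

lemma L_facts: "Im lam \<noteq> 0" "lam \<noteq> 0"
  using L_coordinates[OF L] by (metis less_irrefl, metis less_irrefl zero_complex.sel(2))

text \<open>
  The eigenvalue equation permutes the three coordinates cyclically up to real factors, so \<open>lam ^ 3\<close>
  is real. The rays on which this holds meet the line through the segment in the upper left quadrant
  only at its excluded end point \<open>\<omega>\<close>.
\<close>

lemma klein_three_cycle:
  assumes pat: "klein_pattern g p q r s" and \<pi>: "\<pi> p = q" "\<pi> q = r" "\<pi> r = p" "\<pi> s = s"
  shows False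
proof -
  define X Y Z where "X = z p + z q" and "Y = z p + z r" and "Z = z p + z s"
  define gX gY gZ where "gX = m + g p q - g p r - g p s" and "gY = m + g p r - g p q - g p s"
    and "gZ = m + g p s - g p q - g p r"
  let ?x = "complex_of_real gX" and ?y = "complex_of_real gY" and ?z = "complex_of_real gZ"
  note k = klein_coordinates[OF pat, folded X_def Y_def Z_def gX_def gY_def gZ_def]
  have X: "lam * X = - gZ * Z"
    by (simp only: X_def distrib_left eig4 \<pi> k add.commute[of "Gz q" "Gz p"] of_real_minus mult_minus_left)
  have Y: "lam * Y = gX * X"
    by (simp only: Y_def distrib_left eig4 \<pi> k add.commute[of "Gz q" "Gz p"] of_real_minus mult_minus_left)
  have Z: "lam * Z = - gY * Y"
    by (simp only: Z_def distrib_left eig4 \<pi> k add.commute[of "Gz q" "Gz p"] of_real_minus mult_minus_left)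
  have "lam * (lam * lam - 0 * ?y) - 0 * (- ?x * lam - 0 * 0) + ?z * (- ?x * ?y - lam * 0) = 0"
  proof (rule det3_eq_0_if_kernel)
    show "\<not> (X = 0 \<and> Y = 0 \<and> Z = 0)"
      using coordinates_nonzero by (simp add: X_def Y_def Z_def)
  qed (simp_all add: X Y Z)
  then have "lam ^ 3 + of_real 0 * lam\<^sup>2 + of_real 0 * lam + of_real (- (gX * gY * gZ)) = 0"
    by (simp add: power3_eq_cube mult_ac)
  from L_root_of_cubic[OF L this] obtain e :: real
    where "0 < e" "e < 1 / 6" "0 * (1 - 3 * e) = 0 - 3 * e * (1 - 2 * e)" .
  then show False by simp
qed

text \<open>
  One coordinate is multiplied by a real number and the other two are interchanged up to real
  factors, so \<open>lam\<close> is real or \<open>lam\<^sup>2\<close> is real. The segment meets neither coordinate axis.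
\<close>

lemma klein_four_cycle:
  assumes pat: "klein_pattern g p q r s" and \<pi>: "\<pi> p = q" "\<pi> q = r" "\<pi> r = s" "\<pi> s = p"
  shows False
proof -
  define X Y Z where "X = z p + z q" and "Y = z p + z r" and "Z = z p + z s"
  define gX gY gZ where "gX = m + g p q - g p r - g p s" and "gY = m + g p r - g p q - g p s"
    and "gZ = m + g p s - g p q - g p r"
  let ?x = "complex_of_real gX" and ?y = "complex_of_real gY" and ?z = "complex_of_real gZ"
  note k = klein_coordinates[OF pat, folded X_def Y_def Z_def gX_def gY_def gZ_def]
  have X: "lam * X = - gZ * Z"
    by (simp only: X_def distrib_left eig4 \<pi> k add.commute[of "Gz q" "Gz p"] of_real_minus mult_minus_left)
  have "lam * Y = Gz q + Gz s" by (simp only: Y_def distrib_left eig4 \<pi>)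
  then have Y: "lam * Y = - gY * Y" by (simp only: k of_real_minus mult_minus_left)
  have Z: "lam * Z = gX * X"
    by (simp only: Z_def distrib_left eig4 \<pi> k add.commute[of "Gz q" "Gz p"] of_real_minus mult_minus_left)
  have "lam \<noteq> - gY" using L_facts by auto
  then have "Y = 0" using Y by (metis mult_right_cancel of_real_minus)
  then have nz: "\<not> (X = 0 \<and> Z = 0)"
    using coordinates_nonzero by (simp add: X_def Y_def Z_def)
  have "lam * (lam * 1 - 0 * 0) - ?z * (- ?x * 1 - 0 * 0) + 0 * (- ?x * 0 - lam * 0) = 0"
    by (rule det3_eq_0_if_kernel[of _ X _ Z _ 0]) (use nz in \<open>simp_all add: X Z\<close>)
  then have "lam\<^sup>2 = of_real (- (gX * gZ))" by (simp add: power2_eq_square eq_neg_iff_add_eq_0 mult_ac)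
  then have "Im (lam\<^sup>2) = 0" by (simp only: Im_complex_of_real)
  then have "Re lam = 0" using L_facts by (simp add: power2_eq_square)
  moreover obtain e where "Re lam = - 1 / 2 + 3 / 2 * e" "e < 1 / 6" using L_coordinates[OF L] by metis
  ultimately show False by simp
qed

text \<open>
  The determinant of the eigenvalue equations in the three coordinates is the first of the two cubics,
  with \<open>\<beta> = g p q + g p s\<close>.
\<close>

lemma cyclic_three_cycle:
  assumes pat: "cyclic_pattern g p q r s" and \<pi>: "\<pi> p = q" "\<pi> q = r" "\<pi> r = p" "\<pi> s = s"
  shows False
proof -
  define X Y Z where "X = z p + z q" and "Y = z p + z r" and "Z = z p + z s"
  define u v w where "u = m - g p r" and "v = g p q - g p s" and "w = m + g p r - g p q - g p s"
  let ?u = "complex_of_real u" and ?v = "complex_of_real v" and ?w = "complex_of_real w"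
  note k = cyclic_coordinates[OF pat, folded X_def Y_def Z_def u_def v_def w_def]
  have X: "lam * X = - (u * Z + v * X)"
    by (simp only: X_def distrib_left eig4 \<pi> k add.commute[of "Gz q" "Gz p"] of_real_minus mult_minus_left)
  have Y: "lam * Y = u * X - v * Z"
    by (simp only: Y_def distrib_left eig4 \<pi> k add.commute[of "Gz q" "Gz p"] of_real_minus mult_minus_left)
  have Z: "lam * Z = - w * Y"
    by (simp only: Z_def distrib_left eig4 \<pi> k add.commute[of "Gz q" "Gz p"] of_real_minus mult_minus_left)
  have "(lam + ?v) * (lam * lam - ?v * ?w) - 0 * (- ?u * lam - ?v * 0) + ?u * (- ?u * ?w - lam * 0) = 0"
  proof (rule det3_eq_0_if_kernel)
    show "\<not> (X = 0 \<and> Y = 0 \<and> Z = 0)"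
      using coordinates_nonzero by (simp add: X_def Y_def Z_def)
  qed (simp_all add: X Y Z distrib_right)
  then have "lam ^ 3 + v * lam\<^sup>2 - w * v * lam - w * (u\<^sup>2 + v\<^sup>2) = 0"
    by (simp add: power3_eq_cube power2_eq_square algebra_simps)
  moreover have "w = 1 - 2 * (g p q + g p s)" "g p q + g p s < 1 / 2" "\<bar>v\<bar> \<le> g p q + g p s"
    "\<bar>u\<bar> \<le> 1 - (g p q + g p s)"
    using parameters m by (auto simp: u_def v_def w_def abs_le_iff)
  ultimately show False using three_cycle_cubic_not_on_L[OF L] by metis
qed

text \<open>
  The matrix itself is a circulant here, hence its nonreal eigenvalues \<open>- v \<plusminus> \<i> * u\<close> are convex
  combinations of the fourth roots of unity and lie in the square that the segment avoids.
\<close>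

lemma cyclic_four_cycle:
  assumes pat: "cyclic_pattern g p q r s" and \<pi>: "\<pi> p = q" "\<pi> q = r" "\<pi> r = s" "\<pi> s = p"
  shows False
proof -
  define X Y Z where "X = z p + z q" and "Y = z p + z r" and "Z = z p + z s"
  define u v w where "u = m - g p r" and "v = g p q - g p s" and "w = m + g p r - g p q - g p s"
  let ?u = "complex_of_real u" and ?v = "complex_of_real v" and ?w = "complex_of_real w"
  note k = cyclic_coordinates[OF pat, folded X_def Y_def Z_def u_def v_def w_def]
  have X: "lam * X = - (u * Z + v * X)"
    by (simp only: X_def distrib_left eig4 \<pi> k add.commute[of "Gz q" "Gz p"] of_real_minus mult_minus_left)
  have "lam * Y = Gz q + Gz s" by (simp only: Y_def distrib_left eig4 \<pi>)
  then have Y: "lam * Y = - w * Y" by (simp only: k of_real_minus mult_minus_left)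
  have Z: "lam * Z = u * X - v * Z"
    by (simp only: Z_def distrib_left eig4 \<pi> k add.commute[of "Gz q" "Gz p"] of_real_minus mult_minus_left)
  have "lam \<noteq> - w" using L_facts by auto
  then have "Y = 0" using Y by (metis mult_right_cancel of_real_minus)
  then have nz: "\<not> (X = 0 \<and> Z = 0)"
    using coordinates_nonzero by (simp add: X_def Y_def Z_def)
  have "(lam + ?v) * ((lam + ?v) * 1 - 0 * 0) - ?u * (- ?u * 1 - 0 * 0) + 0 * (- ?u * 0 - (lam + ?v) * 0) = 0"
    by (rule det3_eq_0_if_kernel[of _ X _ Z _ 0]) (use nz in \<open>simp_all add: X Z distrib_right\<close>)
  then have 0: "(lam + v)\<^sup>2 + u\<^sup>2 = 0" by (simp add: power2_eq_square)
  have "(Re lam + v) * Im lam = 0"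
    using arg_cong[OF 0, of Im] by (simp add: power2_eq_square algebra_simps)
  then have v: "Re lam = - v" using L_facts(1) by auto
  have "(Im lam)\<^sup>2 = u\<^sup>2"
    using arg_cong[OF 0, of Re] v by (simp add: power2_eq_square algebra_simps)
  then have "\<bar>Im lam\<bar> = \<bar>u\<bar>" by (simp add: power2_eq_iff abs_eq_iff)
  moreover have "\<bar>u\<bar> + v \<le> 1" using parameters m by (auto simp: u_def v_def)
  moreover have "1 < Im lam - Re lam" using L_coordinates[OF L] by metis
  ultimately show False using v by simp
qed

text \<open>
  Here \<open>\<pi>\<close> is a four-cycle whose opposite pairs differ from those of the cyclic pattern, and the
  determinant of the eigenvalue equations is the second of the two cubics.
\<close>

lemma transverse_cyclic_four_cycle:
  assumes pat: "cyclic_pattern g p q r s" and \<pi>: "\<pi> p = q" "\<pi> q = s" "\<pi> s = r" "\<pi> r = p"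
  shows False
proof -
  define X Y Z where "X = z p + z q" and "Y = z p + z r" and "Z = z p + z s"
  define u v w where "u = m - g p r" and "v = g p q - g p s" and "w = m + g p r - g p q - g p s"
  let ?u = "complex_of_real u" and ?v = "complex_of_real v" and ?w = "complex_of_real w"
  note k = cyclic_coordinates[OF pat, folded X_def Y_def Z_def u_def v_def w_def]
  have X: "lam * X = - w * Y"
    by (simp only: X_def distrib_left eig4 \<pi> k of_real_minus mult_minus_left)
  have Y: "lam * Y = u * X - v * Z"
    by (simp only: Y_def distrib_left eig4 \<pi> k add.commute[of "Gz q" "Gz p"])
  have Z: "lam * Z = - (u * Z + v * X)"
    by (simp only: Z_def distrib_left eig4 \<pi> k)
  have "lam * (lam * (lam + ?u) - ?v * 0) - ?w * (- ?u * (lam + ?u) - ?v * ?v) + 0 * (- ?u * 0 - lam * ?v) = 0"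
  proof (rule det3_eq_0_if_kernel)
    show "\<not> (X = 0 \<and> Y = 0 \<and> Z = 0)"
      using coordinates_nonzero by (simp add: X_def Y_def Z_def)
  qed (simp_all add: X Y Z distrib_right)
  then have "lam ^ 3 + u * lam\<^sup>2 + w * u * lam + w * (u\<^sup>2 + v\<^sup>2) = 0"
    by (simp add: power3_eq_cube power2_eq_square algebra_simps)
  moreover have "u > 0" "w \<le> 1"
    using parameters m by (auto simp: u_def w_def)
  ultimately show False using four_cycle_cubic_not_on_L[OF L] by metis
qed

lemma pattern_cases:
  "klein_pattern g p q r s \<or> cyclic_pattern g p q r s \<or> cyclic_pattern g p q s r \<or> cyclic_pattern g p r q s"
proof -
  have M: "image_mset f (mset_set I) = {#f p, f q, f r, f s#}" for f :: "'a \<Rightarrow> real"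
    using dist by (simp add: I)
  have d: "g p p = m" "g q q = m" "g r r = m" "g s s = m" using diag by (simp_all add: I)
  show ?thesis
  proof (rule latin_pattern_cases)
    have "add_mset m {#g q p, g q r, g q s#} = add_mset m {#g p q, g p r, g p s#}"
      using permutative[of q p] unfolding M d by (simp add: I add_mset_commute)
    then show "{#g q p, g q r, g q s#} = {#g p q, g p r, g p s#}" by (simp only: add_mset_add_mset_same_iff)
    have "add_mset m {#g r p, g r q, g r s#} = add_mset m {#g p q, g p r, g p s#}"
      using permutative[of r p] unfolding M d by (simp add: I add_mset_commute)
    then show "{#g r p, g r q, g r s#} = {#g p q, g p r, g p s#}" by (simp only: add_mset_add_mset_same_iff)
    have "add_mset m {#g s p, g s q, g s r#} = add_mset m {#g p q, g p r, g p s#}"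
      using permutative[of s p] unfolding M d by (simp add: I add_mset_commute)
    then show "{#g s p, g s q, g s r#} = {#g p q, g p r, g p s#}" by (simp only: add_mset_add_mset_same_iff)
  qed (use col[of p] col[of q] col[of r] col[of s] row[of p] in \<open>simp_all add: sum4 d, simp_all add: I\<close>)
qed

end

text \<open>
  Conjugation by a three-cycle permutes the three cyclic patterns transitively, so that relabelling
  reduces them all to one.
\<close>

lemma no_three_cycle:
  assumes I: "I = {p, q, r, s}" and dist: "distinct [p, q, r, s]"
    and \<pi>: "\<pi> p = q" "\<pi> q = r" "\<pi> r = p" "\<pi> s = s"
  shows False
proof -
  have I': "I = {r, p, q, s}" "distinct [r, p, q, s]" "I = {q, r, p, s}" "distinct [q, r, p, s]"
    using I dist by auto
  consider "klein_pattern g p q r s" | "cyclic_pattern g p q r s" | "cyclic_pattern g p q s r"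
    | "cyclic_pattern g p r q s" using pattern_cases[OF I dist] by blast
  then show False
  proof cases
    case 1 then show False using klein_three_cycle[OF I dist] \<pi> by blast
  next
    case 2 then show False using cyclic_three_cycle[OF I dist] \<pi> by blast
  next
    case 3
    then have "cyclic_pattern g r p q s" by (simp add: cyclic_pattern_def)
    then show False using cyclic_three_cycle[OF I'(1,2)] \<pi> by blast
  next
    case 4
    then have "cyclic_pattern g q r p s" by (simp add: cyclic_pattern_def)
    then show False using cyclic_three_cycle[OF I'(3,4)] \<pi> by blast
  qed
qed

text \<open>
  Conjugation by a four-cycle preserves the cyclic pattern with the same opposite pairs and exchanges
  the other two.
\<close>

lemma no_four_cycle:
  assumes I: "I = {p, q, r, s}" and dist: "distinct [p, q, r, s]"
    and \<pi>: "\<pi> p = q" "\<pi> q = r" "\<pi> r = s" "\<pi> s = p"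
  shows False
proof -
  have I': "I = {p, q, s, r}" "distinct [p, q, s, r]" "I = {q, r, p, s}" "distinct [q, r, p, s]"
    using I dist by auto
  consider "klein_pattern g p q r s" | "cyclic_pattern g p q r s" | "cyclic_pattern g p q s r"
    | "cyclic_pattern g p r q s" using pattern_cases[OF I dist] by blast
  then show False
  proof cases
    case 1 then show False using klein_four_cycle[OF I dist] \<pi> by blast
  next
    case 2 then show False using cyclic_four_cycle[OF I dist] \<pi> by blast
  next
    case 3 then show False using transverse_cyclic_four_cycle[OF I'(1,2)] \<pi> by blast
  next
    case 4
    then have "cyclic_pattern g q r p s" by (simp add: cyclic_pattern_def)
    then show False using transverse_cyclic_four_cycle[OF I'(3,4)] \<pi> by blast
  qed
qed

end

section \<open>Permutative doubly stochastic matrices\<close>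

lemma non_involution_on_four_points:
  assumes I: "card I = 4" and bij: "bij_betw \<pi> I I" and "\<exists>i\<in>I. \<pi> (\<pi> i) \<noteq> i"
  obtains p q r s where "I = {p, q, r, s}" "distinct [p, q, r, s]" "\<pi> p = q" "\<pi> q = r"
    "\<pi> r = p \<and> \<pi> s = s \<or> \<pi> r = s \<and> \<pi> s = p"
proof -
  obtain p where p: "p \<in> I" "\<pi> (\<pi> p) \<noteq> p" using assms(3) by blast
  define q where "q = \<pi> p"
  define r where "r = \<pi> q"
  have inI: "q \<in> I" "r \<in> I" using p bij by (auto simp: q_def r_def bij_betw_apply)
  have inj: "\<pi> x = \<pi> y \<longleftrightarrow> x = y" if "x \<in> I" "y \<in> I" for x y
    using bij that by (auto simp: bij_betw_def inj_on_eq_iff)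
  have d: "p \<noteq> q" "q \<noteq> r" "r \<noteq> p"
    using p inI inj[of p q] by (auto simp: q_def r_def)
  have "card (I - {p, q, r}) = 1"
    using I p inI d by (subst card_Diff_subset) auto
  then obtain s where s: "I - {p, q, r} = {s}" by (auto simp: card_1_singleton_iff)
  then have Is: "I = {p, q, r, s}" "s \<in> I" "s \<noteq> p" "s \<noteq> q" "s \<noteq> r" using p inI by auto
  have "\<pi> r \<in> I" "\<pi> s \<in> I" using bij_betw_apply[OF bij] inI(2) Is(2) by blast+
  moreover have "\<pi> r \<noteq> q" "\<pi> r \<noteq> r" "\<pi> s \<noteq> q" "\<pi> s \<noteq> r" "\<pi> r \<noteq> \<pi> s"
    using inj[of r p] inj[of r q] inj[of s p] inj[of s q] inj[of r s] p inI d Is(2-5)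
    by (simp_all add: q_def[symmetric] r_def[symmetric])
  ultimately have "\<pi> r = p \<and> \<pi> s = s \<or> \<pi> r = s \<and> \<pi> s = p" unfolding Is(1) by auto
  then show thesis
    using d Is(3-5) by (intro that[OF Is(1) _ q_def[symmetric] r_def[symmetric]]) auto
qed

text \<open>
  The large entry \<open>m\<close> gives the permutation \<open>\<pi>\<close>, and its cycle type decides which of the previous
  results applies.
\<close>

lemma PDS_no_eigenvalue_on_L:
  fixes a :: "'a \<Rightarrow> 'a \<Rightarrow> real" and z :: "'a \<Rightarrow> complex"
  assumes cI: "card I = 4" and nonneg: "\<And>i j. i \<in> I \<Longrightarrow> j \<in> I \<Longrightarrow> 0 \<le> a i j"
    and row: "\<And>i. i \<in> I \<Longrightarrow> (\<Sum>j\<in>I. a i j) = 1"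
    and col: "\<And>j. j \<in> I \<Longrightarrow> (\<Sum>i\<in>I. a i j) = 1"
    and perm: "\<And>i. i \<in> I \<Longrightarrow> image_mset (a i) (mset_set I) = M"
    and eig: "\<And>i. i \<in> I \<Longrightarrow> lam * z i = (\<Sum>j\<in>I. of_real (a i j) * z j)"
    and nz: "\<exists>i\<in>I. z i \<noteq> 0"
  shows "lam \<notin> L"
proof
  assume L: "lam \<in> L"
  obtain e where e: "Re lam = - 1 / 2 + 3 / 2 * e" "(Im lam)\<^sup>2 = 3 / 4 * (1 - e)\<^sup>2"
    "0 < Im lam" "0 < e" "e < 1 / 6" "1 < Im lam - Re lam" using L_coordinates[OF L] .
  have I: "finite I" "I \<noteq> {}" using cI by (auto intro: card_ge_0_finite)
  have "lam \<noteq> 1" using e(3) by auto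
  then have sum0: "sum z I = 0" using doubly_stochastic_eigenvector_sum_0 col eig by metis
  have norm: "(cmod lam)\<^sup>2 > 1 / 2"
  proof -
    have "(cmod lam)\<^sup>2 = 1 - 3 * e + 3 * e\<^sup>2"
      unfolding cmod_power2 e(1,2) by (simp add: power2_eq_square field_simps)
    moreover have "3 * e\<^sup>2 \<ge> 0" by simp
    ultimately show ?thesis using e(5) by linarith
  qed
  have sq: "(\<Sum>j\<in>I. (a i j)\<^sup>2) = \<Sum>\<^sub># (image_mset power2 M)" if "i \<in> I" for i
    unfolding perm[OF that, symmetric]
    by (simp add: sum_unfold_sum_mset multiset.map_comp o_def)
  have "1 + 2 * (cmod lam)\<^sup>2 \<le> (\<Sum>i\<in>I. \<Sum>j\<in>I. (a i j)\<^sup>2)"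
    using frobenius_ge_complex_eigenvalue[OF I(1) row eig sum0 nz] e(3) by simp
  also have "\<dots> = 4 * \<Sum>\<^sub># (image_mset power2 M)" by (simp add: sq cI)
  finally have sqM: "\<Sum>\<^sub># (image_mset power2 M) > 1 / 2" using norm by linarith
  have "\<exists>m. m \<in># M \<and> m > 1 / 2"
  proof (rule ccontr)
    assume small: "\<not> ?thesis"
    obtain i where i: "i \<in> I" using I(2) by blast
    have "a i j \<le> 1 / 2" if "j \<in> I" for j
    proof -
      have "a i j \<in># M" using that I(1) unfolding perm[OF i, symmetric] by simp
      then show ?thesis using small by force
    qed
    then have "(\<Sum>j\<in>I. (a i j)\<^sup>2) \<le> (\<Sum>j\<in>I. 1 / 2 * a i j)"
      unfolding power2_eq_square using nonneg[OF i] by (intro sum_mono mult_right_mono) auto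
    also have "\<dots> = 1 / 2" unfolding sum_distrib_left[symmetric] by (simp add: row[OF i])
    finally show False using sqM sq[OF i] by simp
  qed
  then obtain m where m: "m \<in># M" "m > 1 / 2" by blast
  have "\<forall>i\<in>I. \<exists>j\<in>I. a i j = m"
  proof
    fix i assume "i \<in> I"
    then have "m \<in># image_mset (a i) (mset_set I)" using m(1) perm by simp
    then show "\<exists>j\<in>I. a i j = m" using I(1) by auto
  qed
  then obtain \<pi> where \<pi>: "\<And>i. i \<in> I \<Longrightarrow> \<pi> i \<in> I" "\<And>i. i \<in> I \<Longrightarrow> a i (\<pi> i) = m" by metis
  have inj: "inj_on \<pi> I"
  proof (rule inj_onI, rule ccontr)
    fix i k assume ik: "i \<in> I" "k \<in> I" "\<pi> i = \<pi> k" "i \<noteq> k"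
    have "m + m = (\<Sum>l\<in>{i, k}. a l (\<pi> i))" using ik \<pi>(2)[of i] \<pi>(2)[of k] by simp
    also have "\<dots> \<le> (\<Sum>l\<in>I. a l (\<pi> i))"
      using ik I \<pi>(1) nonneg by (intro sum_mono2) auto
    also have "\<dots> = 1" using col \<pi>(1) ik by simp
    finally show False using m(2) by simp
  qed
  have bij: "bij_betw \<pi> I I"
    unfolding bij_betw_def using inj \<pi>(1) endo_inj_surj[OF I(1) _ inj] by blast
  define \<sigma> where "\<sigma> = inv_into I \<pi>"
  have \<sigma>: "bij_betw \<sigma> I I" "\<And>i. i \<in> I \<Longrightarrow> \<sigma> i \<in> I" "\<And>i. i \<in> I \<Longrightarrow> \<pi> (\<sigma> i) = i" "\<And>i. i \<in> I \<Longrightarrow> \<sigma> (\<pi> i) = i"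
    using bij_betw_inv_into[OF bij] bij_betw_inv_into_right[OF bij] bij_betw_inv_into_left[OF bij]
    by (auto simp: \<sigma>_def bij_betw_apply)
  interpret g: permuted_eigenvector I "\<lambda>i. a (\<sigma> i)" \<pi> m z lam
  proof
    show "(\<Sum>i\<in>I. a (\<sigma> i) j) = 1" if "j \<in> I" for j
      using sum.reindex_bij_betw[OF \<sigma>(1), of "\<lambda>i. a i j"] col[OF that] by simp
    show "a (\<sigma> i) i = m" if "i \<in> I" for i using \<pi>(2)[of "\<sigma> i"] \<sigma> that by simp
    show "lam * z i = (\<Sum>j\<in>I. of_real (a (\<sigma> (\<pi> i)) j) * z j)" if "i \<in> I" for i
      using eig[OF that] \<sigma>(4)[OF that] by simp
  qed (use nonneg row perm \<sigma>(2) m(2) sum0 nz L in auto)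
  show False
  proof (cases "\<forall>i\<in>I. \<pi> (\<pi> i) = i")
    case True
    then have "\<bar>Im lam\<bar> \<le> 1 - m"
      by (intro Im_eigenvalue_le_if_heavy_involution[OF I(1) nonneg row col \<pi>(1) _ \<pi>(2) eig nz]) auto
    then show False using m(2) e by linarith
  next
    case False
    then obtain p q r s where "I = {p, q, r, s}" "distinct [p, q, r, s]" "\<pi> p = q" "\<pi> q = r"
      "\<pi> r = p \<and> \<pi> s = s \<or> \<pi> r = s \<and> \<pi> s = p"
      using non_involution_on_four_points[OF cI bij] by blast
    then show False using g.no_three_cycle g.no_four_cycle by blast
  qed
qed

theorem theorem3p12:
  fixes A :: "real mat" and z :: complex
  assumes "A \<in> carrier_mat 4 4" and "PDS A" and "z \<in> L"
  shows "\<not> eigenvalue (map_mat complex_of_real A) z"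
proof
  assume "eigenvalue (map_mat complex_of_real A) z"
  moreover have dim: "dim_row A = 4" "dim_col A = 4" using assms(1) by auto
  ultimately obtain v where v: "v \<in> carrier_vec 4" "v \<noteq> 0\<^sub>v 4"
      "map_mat complex_of_real A *\<^sub>v v = z \<cdot>\<^sub>v v"
    by (auto simp: eigenvalue_def eigenvector_def)
  have "z \<notin> L"
  proof (rule PDS_no_eigenvalue_on_L[where I = "{..<4}" and a = "\<lambda>i j. A $$ (i, j)"
        and z = "\<lambda>i. v $ i" and M = "image_mset (\<lambda>j. A $$ (0, j)) (mset_set {..<4})"])
    show "card {..<4::nat} = 4" by simp
    show "0 \<le> A $$ (i, j)" if "i \<in> {..<4}" "j \<in> {..<4}" for i j
      using assms(2) that by (simp add: PDS_def doubly_stochastic_def dim)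
    show "(\<Sum>j<4. A $$ (i, j)) = 1" if "i \<in> {..<4}" for i
      using assms(2) that by (simp add: PDS_def doubly_stochastic_def dim)
    show "(\<Sum>i<4. A $$ (i, j)) = 1" if "j \<in> {..<4}" for j
      using assms(2) that by (simp add: PDS_def doubly_stochastic_def dim)
    show "image_mset (\<lambda>j. A $$ (i, j)) (mset_set {..<4})
        = image_mset (\<lambda>j. A $$ (0, j)) (mset_set {..<4})" if i: "i \<in> {..<4}" for i
    proof -
      obtain p where p: "p permutes {..<4}" "\<forall>j<4. A $$ (i, j) = A $$ (0, p j)"
        using assms(2) i by (auto simp: PDS_def permutative_def dim)
      have "image_mset (\<lambda>j. A $$ (i, j)) (mset_set {..<4})
          = image_mset (\<lambda>j. A $$ (0, j)) (image_mset p (mset_set {..<4}))"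
        unfolding multiset.map_comp o_def by (rule image_mset_cong) (use p(2) in simp)
      also have "image_mset p (mset_set {..<4}) = mset_set {..<4}"
        using p(1) by (simp add: image_mset_mset_set permutes_inj_on permutes_image)
      finally show ?thesis .
    qed
    show "z * v $ i = (\<Sum>j<4. complex_of_real (A $$ (i, j)) * v $ j)" if "i \<in> {..<4}" for i
      using arg_cong[OF v(3), of "\<lambda>w. w $ i"] that v(1) dim
      by (simp add: scalar_prod_def atLeast0LessThan)
    show "\<exists>i\<in>{..<4}. v $ i \<noteq> 0"
      using v(1,2) by (auto simp: vec_eq_iff)
  qed
  then show False using assms(3) by simp
qed

end
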